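(* Let $n\equiv 1\pmod 4$ be a positive integer and let $a$ be an indeterminate. Then, modulo $[n](1-aq^n)(a-q^n)$, \[ \sum_{k=0}^{(n-1)/4}[8k+1]\frac{(q;q^4)_k^2(aq;q^4)_k(q/a;q^4)_k}{(q^4;q^4)_k^2(aq^4;q^4)_k(q^4/a;q^4)_k}q^{2k}\equiv \frac{(q^2;q^4)_{(n-1)/4}}{(q^4;q^4)_{(n-1)/4}}[n]\,q^{(1-n)/4}. \]
   Context: For an indeterminate $q$, $(x;q)_k=(1-x)(1-xq)\cdots(1-xq^{k-1})$ (with $(x;q)_0=1$). For an integer $m$, $[m]=(1-q^m)/(1-q)$. A congruence $A\equiv B\pmod{P}$ between rational functions in $q$ and $a$ means that $A-B$, written as a quotient of polynomials with denominator coprime to $P$, has numerator divisible by $P$ (in the polynomial ring in $q,a$). *)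

theory Defs
  imports "HOL-Computational_Algebra.Polynomial" "HOL-Computational_Algebra.Fraction_Field"
begin

(* Polynomials in q and a with integer coefficients: int poly poly,
   outer variable q, inner variable a. Rational functions: its fraction field. *)
type_synonym rf = "int poly poly fract"

definition qv :: "int poly poly" where "qv = [:0, 1:]"
definition av :: "int poly poly" where "av = [:[:0, 1:]:]"

definition rq :: rf where "rq = Fract qv 1"
definition ra :: rf where "ra = Fract av 1"

definition qpoch :: "rf \<Rightarrow> rf \<Rightarrow> nat \<Rightarrow> rf" where
  "qpoch x p k = (\<Prod>j<k. 1 - x * p ^ j)"

definition qint :: "nat \<Rightarrow> rf" where
  "qint m = (1 - rq ^ m) / (1 - rq)"

definition qint_poly :: "nat \<Rightarrow> int poly poly" where
  "qint_poly m = (\<Sum>i<m. qv ^ i)"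

definition cong_rf :: "rf \<Rightarrow> rf \<Rightarrow> int poly poly \<Rightarrow> bool" where
  "cong_rf A B P \<longleftrightarrow>
     (\<exists>N D. D \<noteq> 0 \<and> coprime D P \<and> P dvd N \<and> A - B = Fract N D)"

end

theory Submission
  imports Defs "HOL-Computational_Algebra.Polynomial_Factorial"
    "HOL-Computational_Algebra.Normalized_Fraction" Complex_Main
begin

text \<open>
  Write the difference of the two sides as a reduced fraction \<open>N / D\<close>. It suffices that \<open>N\<close> vanishes
  under the substitutions \<open>a = q\<^sup>n\<close>, \<open>a = 1 / q\<^sup>n\<close>, and \<open>q = \<zeta>\<close> for every complex \<open>\<zeta> \<noteq> 1\<close> with
  \<open>\<zeta>\<^sup>n = 1\<close>: their kernels then allow the three factors of the modulus to be split off one after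
  the other.

  For \<open>a = q\<^sup>n\<close> or \<open>a = 1 / q\<^sup>n\<close> the two sides agree exactly, by a terminating very-well-poised
  \<open>6\<phi>5\<close> summation in base \<open>q\<^sup>4\<close>, which is proved by a WZ pair.

  Let \<open>\<zeta>\<close> have order \<open>d\<close> and let \<open>e = ((n - 1) / 4) mod d\<close>. Numerators and denominators of the
  summands may vanish at \<open>\<zeta>\<close>, but in the same number over each block of \<open>d\<close> consecutive factors.
  The \<open>l\<close>-th block of \<open>d\<close> summands is therefore, at \<open>\<zeta>\<close>, a multiple of the first; its
  terms beyond \<open>e\<close> vanish, and the terms \<open>s\<close> and \<open>e - s\<close> cancel.
\<close>

section \<open>Values of rational functions under a substitution\<close>

text \<open>Used twice, for the inner polynomials in a and then for the outer ones in q, to make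
  \<open>ev\<close> a ring homomorphism.\<close>

lemma poly_map_poly_hom:
  fixes h :: "'a::comm_ring_1 \<Rightarrow> 'b::comm_ring_1"
  assumes h: "h 0 = 0" "\<And>a b. h (a + b) = h a + h b" "\<And>a b. h (a * b) = h a * h b"
  shows "poly (map_poly h (p + r)) x = poly (map_poly h p) x + poly (map_poly h r) x"
    and "poly (map_poly h (p * r)) x = poly (map_poly h p) x * poly (map_poly h r) x"
proof -
  have add: "poly (map_poly h (p + r)) x = poly (map_poly h p) x + poly (map_poly h r) x" for p r
  proof (induction p r rule: poly_induct2)
    case (pCons a p b r)
    then show ?case by (simp add: map_poly_pCons h algebra_simps)
  qed simp
  have smult: "poly (map_poly h (smult c p)) x = h c * poly (map_poly h p) x" for c p
    by (induction p) (simp_all add: map_poly_pCons h algebra_simps)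
  show "poly (map_poly h (p + r)) x = poly (map_poly h p) x + poly (map_poly h r) x"
    by (rule add)
  show "poly (map_poly h (p * r)) x = poly (map_poly h p) x * poly (map_poly h r) x"
    by (induction p) (simp_all add: map_poly_pCons h add smult algebra_simps)
qed

locale field_hom =
  fixes \<phi> :: "'a::idom \<Rightarrow> 'b::field"
  assumes hom_1 [simp]: "\<phi> 1 = 1"
    and hom_add [simp]: "\<phi> (a + b) = \<phi> a + \<phi> b"
    and hom_mult [simp]: "\<phi> (a * b) = \<phi> a * \<phi> b"
begin

lemma hom_0 [simp]: "\<phi> 0 = 0"
  using hom_add[of 0 0] by (metis add_0 add_cancel_right_right)

lemma hom_uminus [simp]: "\<phi> (- a) = - \<phi> a"
  using hom_add[of a "- a"] by (simp add: eq_neg_iff_add_eq_0 add.commute)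

lemma hom_diff [simp]: "\<phi> (a - b) = \<phi> a - \<phi> b"
  using hom_add[of a "- b"] by simp

lemma hom_power [simp]: "\<phi> (a ^ k) = \<phi> a ^ k"
  by (induction k) simp_all

lemma hom_sum: "\<phi> (sum f S) = (\<Sum>i\<in>S. \<phi> (f i))"
  by (induction S rule: infinite_finite_induct) simp_all

text \<open>The fraction lies in the localization at the kernel of \<open>\<phi>\<close>, with
  residue \<open>v\<close>. A relation, since other fractions have no value; as any representation
  may serve, common factors killed by \<open>\<phi>\<close> can be cancelled first.\<close>

definition hasval :: "'a fract \<Rightarrow> 'b \<Rightarrow> bool" where
  "hasval f v \<longleftrightarrow> (\<exists>N D. f = Fract N D \<and> \<phi> D \<noteq> 0 \<and> v = \<phi> N / \<phi> D)"

lemma hasval_Fract: "\<phi> D \<noteq> 0 \<Longrightarrow> hasval (Fract N D) (\<phi> N / \<phi> D)"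
  unfolding hasval_def by blast

lemma hasval_whole: "hasval (Fract N 1) (\<phi> N)"
  using hasval_Fract[of 1 N] by simp

lemma hasval_1: "hasval 1 1"
  using hasval_whole[of 1] by (simp add: One_fract_def)

lemma hasval_0: "hasval 0 0"
  using hasval_whole[of 0] by (simp add: Zero_fract_def)

lemma hasval_add:
  assumes "hasval f u" "hasval g v" shows "hasval (f + g) (u + v)"
proof -
  obtain N D N' D' where *: "f = Fract N D" "\<phi> D \<noteq> 0" "u = \<phi> N / \<phi> D"
    "g = Fract N' D'" "\<phi> D' \<noteq> 0" "v = \<phi> N' / \<phi> D'"
    using assms unfolding hasval_def by blast
  then have "D \<noteq> 0" "D' \<noteq> 0" by auto
  with * hasval_Fract[of "D * D'" "N * D' + N' * D"] show ?thesis
    by (simp add: add_frac_eq)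
qed

lemma hasval_mult:
  assumes "hasval f u" "hasval g v" shows "hasval (f * g) (u * v)"
proof -
  obtain N D N' D' where *: "f = Fract N D" "\<phi> D \<noteq> 0" "u = \<phi> N / \<phi> D"
    "g = Fract N' D'" "\<phi> D' \<noteq> 0" "v = \<phi> N' / \<phi> D'"
    using assms unfolding hasval_def by blast
  with hasval_Fract[of "D * D'" "N * N'"] show ?thesis by simp
qed

lemma hasval_uminus: "hasval f u \<Longrightarrow> hasval (- f) (- u)"
  unfolding hasval_def by (metis hom_uminus minus_divide_left minus_fract)

lemma hasval_diff: "hasval f u \<Longrightarrow> hasval g v \<Longrightarrow> hasval (f - g) (u - v)"
  using hasval_add[of f u "- g" "- v"] hasval_uminus by simp

lemma hasval_inverse:
  assumes "hasval f u" "u \<noteq> 0" shows "hasval (inverse f) (inverse u)"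
proof -
  obtain N D where *: "f = Fract N D" "\<phi> D \<noteq> 0" "u = \<phi> N / \<phi> D"
    using assms unfolding hasval_def by blast
  with assms(2) hasval_Fract[of N D] show ?thesis by simp
qed

lemma hasval_divide: "hasval f u \<Longrightarrow> hasval g v \<Longrightarrow> v \<noteq> 0 \<Longrightarrow> hasval (f / g) (u / v)"
  by (simp add: divide_inverse hasval_mult hasval_inverse)

lemma hasval_power: "hasval f u \<Longrightarrow> hasval (f ^ k) (u ^ k)"
  by (induction k) (simp_all add: hasval_1 hasval_mult)

lemma hasval_sum: "(\<And>i. i \<in> S \<Longrightarrow> hasval (f i) (u i)) \<Longrightarrow> hasval (sum f S) (sum u S)"
  by (induction S rule: infinite_finite_induct) (simp_all add: hasval_0 hasval_add)

lemma hasval_prod: "(\<And>i. i \<in> S \<Longrightarrow> hasval (f i) (u i)) \<Longrightarrow> hasval (prod f S) (prod u S)"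
  by (induction S rule: infinite_finite_induct) (simp_all add: hasval_1 hasval_mult)

lemmas hasval_intros = hasval_1 hasval_add hasval_diff hasval_mult hasval_divide hasval_power
  hasval_prod

text \<open>Cross-multiplication with a representation that witnesses the value. The given
  \<open>D\<close> may itself be killed by \<open>\<phi>\<close>.\<close>

lemma hom_eq_0_if_hasval_0:
  assumes "hasval (Fract N D) 0" "D \<noteq> 0" shows "\<phi> N = 0"
proof -
  obtain N' D' where *: "Fract N D = Fract N' D'" "\<phi> D' \<noteq> 0" "\<phi> N' = 0"
    using assms(1) unfolding hasval_def by auto
  then have "D' \<noteq> 0" by auto
  with * assms(2) have "N * D' = N' * D" by (simp add: eq_fract)
  then have "\<phi> N * \<phi> D' = 0" using * by (metis hom_mult mult_zero_left)
  with * show ?thesis by simp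
qed

end

section \<open>Evaluation of polynomials at q = x, a = y\<close>

definition ev :: "'b::field \<Rightarrow> 'b \<Rightarrow> int poly poly \<Rightarrow> 'b" where
  "ev x y N = poly (map_poly (\<lambda>c. poly (map_poly of_int c) y) N) x"

lemma ev_pCons: "ev x y (pCons c N) = poly (map_poly of_int c) y + x * ev x y N"
  by (simp add: ev_def map_poly_pCons)

interpretation ev: field_hom "ev x y" for x y :: "'b::field"
proof
  fix a b :: "int poly poly"
  note of_int = poly_map_poly_hom[of "of_int :: int \<Rightarrow> 'b", simplified]
  note * = poly_map_poly_hom[of "\<lambda>c. poly (map_poly of_int c) y", simplified of_int, simplified]
  show "ev x y (a + b) = ev x y a + ev x y b" "ev x y (a * b) = ev x y a * ev x y b"
    unfolding ev_def by (simp_all add: *)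
  show "ev x y 1 = 1" by (simp add: ev_def map_poly_1')
qed

lemma qv_power: "qv ^ k = monom 1 k"
  by (simp add: qv_def monom_altdef)

lemma ev_qv [simp]: "ev x y qv = x" and ev_av [simp]: "ev x y av = y"
  by (simp_all add: qv_def av_def ev_pCons map_poly_pCons)

lemma hasval_rq: "ev.hasval x y rq x" and hasval_ra: "ev.hasval x y ra y"
  using ev.hasval_whole[of x y qv] ev.hasval_whole[of x y av] by (simp_all add: rq_def ra_def)

section \<open>Divisibility from vanishing under substitutions\<close>

lemma cong_rfI:
  assumes "A - B = Fract N D" "D \<noteq> 0" "coprime N D" "P dvd N"
  shows "cong_rf A B P"
  \<comment> \<open>A common divisor of \<open>D\<close> and \<open>P\<close> also divides
    \<open>N\<close>, hence is a unit.\<close>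
  unfolding cong_rf_def using assms
  by (metis coprime_commute coprime_divisors dvd_refl)

lemma ex_reduced_Fract:
  fixes f :: rf
  obtains N D where "f = Fract N D" "D \<noteq> 0" "coprime N D"
  using coprime_quot_of_fract[of f] Fract_quot_of_fract[of f] snd_quot_of_fract_nonzero[of f] by metis

text \<open>Modulo \<open>w - v a\<close> every polynomial becomes, after multiplication by a power of \<open>v\<close>, a
  polynomial in \<open>q\<close> alone.\<close>

lemma dvd_if_ev_eq_0:
  fixes v w N P :: "int poly poly" and x y :: "'b::field"
  assumes P: "P dvd w - v * av"
    and v: "v = map_poly (\<lambda>c. [:c:]) v'" and w: "w = map_poly (\<lambda>c. [:c:]) w'"
    and cop: "coprime P v"
    and inj: "\<And>g :: int poly. poly (map_poly of_int g) x = 0 \<Longrightarrow> g = 0"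
    and P0: "ev x y P = 0"
    and N: "ev x y N = 0"
  shows "P dvd N"
proof -
  \<comment> \<open>\<open>emb\<close> regards a polynomial in q alone as one in q and a.\<close>
  define emb :: "int poly \<Rightarrow> int poly poly" where "emb = map_poly (\<lambda>c. [:c:])"
  have emb_pCons: "emb (pCons c g) = [:[:c:]:] + qv * emb g" for c g
    by (simp add: emb_def map_poly_pCons qv_def)
  have emb_add: "emb (g + h) = emb g + emb h" for g h
    unfolding emb_def by (intro poly_eqI) (simp add: coeff_map_poly)
  have emb_smult: "emb (smult c g) = [:[:c:]:] * emb g" for c g
    unfolding emb_def by (intro poly_eqI) (simp add: coeff_map_poly mult.commute)
  have emb_mult: "emb (g * h) = emb g * emb h" for g h
  proof (induction g)
    case (pCons c g)
    have "emb (pCons c g * h) = emb (smult c h) + emb (pCons 0 (g * h))"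
      by (simp add: emb_add)
    also have "\<dots> = emb (pCons c g) * emb h"
      by (simp only: emb_smult emb_pCons pCons.IH) (simp add: algebra_simps)
    finally show ?case .
  qed (simp add: emb_def)
  have emb_power: "emb (g ^ k) = emb g ^ k" for g k
    by (induction k) (simp_all add: emb_mult, simp add: emb_def map_poly_pCons one_pCons)
  have v: "v = emb v'" and w: "w = emb w'" using v w by (simp_all add: emb_def)
  \<comment> \<open>Modulo \<open>P\<close>, \<open>w\<close> equals \<open>v * av\<close>, so each
    power of a is removed at the cost of one factor \<open>v\<close>.\<close>
  have inner: "\<exists>L g. P dvd v ^ L * [:c:] - emb g" for c :: "int poly"
  proof (induction c)
    case 0
    have "P dvd v ^ 0 * [:0:] - emb 0" by (simp add: emb_def)
    then show ?case by blast
  next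
    case (pCons b c)
    then obtain L g where L: "P dvd v ^ L * [:c:] - emb g" by blast
    have eq: "[:pCons b c:] = [:[:b:]:] + av * [:c:]" by (simp add: av_def)
    have "emb (smult b (v' ^ Suc L) + w' * g) = [:[:b:]:] * v ^ Suc L + w * emb g"
      by (simp only: emb_add emb_smult emb_mult emb_power v w)
    then have "v ^ Suc L * [:pCons b c:] - emb (smult b (v' ^ Suc L) + w' * g)
      = w * (v ^ L * [:c:] - emb g) - (w - v * av) * (v ^ L * [:c:])"
      by (simp only: eq) (simp add: algebra_simps smult_diff_right)
    moreover have "P dvd w * (v ^ L * [:c:] - emb g) - (w - v * av) * (v ^ L * [:c:])"
      using dvd_diff[OF dvd_mult[OF L] dvd_mult2[OF P]] .
    ultimately show ?case by metis
  qed
  \<comment> \<open>Horner recursion in q; adding the two exponents gives a common power of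
    \<open>v\<close>.\<close>
  have "\<exists>L g. P dvd v ^ L * N - emb g" for N
  proof (induction N)
    case 0
    have "P dvd v ^ 0 * 0 - emb 0" by (simp add: emb_def)
    then show ?case by blast
  next
    case (pCons c N)
    then obtain L g where L: "P dvd v ^ L * N - emb g" by blast
    obtain K h where K: "P dvd v ^ K * [:c:] - emb h" using inner by blast
    have eq: "pCons c N = [:c:] + qv * N" by (simp add: qv_def)
    have "emb (v' ^ L * h + pCons 0 (v' ^ K * g)) = v ^ L * emb h + qv * (v ^ K * emb g)"
      by (simp add: emb_add emb_pCons emb_mult emb_power v)
    then have "v ^ (L + K) * pCons c N - emb (v' ^ L * h + pCons 0 (v' ^ K * g))
       = v ^ L * (v ^ K * [:c:] - emb h) + qv * v ^ K * (v ^ L * N - emb g)"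
      by (simp only: eq) (simp add: algebra_simps power_add)
    moreover have "P dvd v ^ L * (v ^ K * [:c:] - emb h) + qv * v ^ K * (v ^ L * N - emb g)"
      using L K by (intro dvd_add dvd_mult)
    ultimately show ?case by metis
  qed
  then obtain L g where g: "P dvd v ^ L * N - emb g" by blast
  \<comment> \<open>Where \<open>P\<close> and \<open>N\<close> vanish, so does
    \<open>emb g\<close>; thus \<open>x\<close> is a root of \<open>g\<close>, and
    \<open>inj\<close> gives \<open>g = 0\<close>.\<close>
  then have "ev x y (v ^ L * N - emb g) = 0"
    using P0 by (metis dvdE ev.hom_mult mult_zero_left)
  then have "ev x y (emb g) = 0" using N by simp
  moreover have "ev x y (emb g) = poly (map_poly of_int g) x"
    by (induction g) (simp_all add: emb_pCons map_poly_pCons ev_pCons, simp add: emb_def)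
  ultimately have "g = 0" using inj by simp
  with g have "P dvd v ^ L * N" by (simp add: emb_def)
  with cop show ?thesis by (meson coprime_dvd_mult_right_iff coprime_power_right_iff)
qed

text \<open>Provides \<open>inj\<close> in \<open>dvd_if_ev_eq_0\<close> for q = \<open>rq\<close>:
  the value is the polynomial itself, seen in the fraction field.\<close>

lemma poly_of_int_rq: 
  fixes g :: "int poly" assumes "poly (map_poly of_int g) rq = 0" shows "g = 0"
proof -
  have of_int: "(of_int c :: rf) = Fract [:[:c:]:] 1" for c
    by (cases c) (simp_all add: of_nat_fract Zero_fract_def One_fract_def of_nat_poly one_pCons)
  have "poly (map_poly of_int g) rq = Fract (map_poly (\<lambda>c. [:c:]) g) 1"
    by (induction g) (simp_all add: map_poly_pCons Zero_fract_def of_int rq_def qv_def)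
  with assms have "map_poly (\<lambda>c. [:c:]) g = 0"
    by (simp add: Zero_fract_def eq_fract)
  then have "[:coeff g i:] = 0" for i
    by (metis coeff_map_poly coeff_0 pCons_0_0)
  then show ?thesis by (intro poly_eqI) simp
qed

text \<open>A nonzero remainder modulo the monic \<open>qint_poly n\<close> would have degree below
  n - 1 in q, yet n - 1 roots in C(a): the nontrivial n-th roots of unity.\<close>

lemma qint_poly_dvd_if:
  fixes N :: "int poly poly"
  assumes n: "n > 0"
    and N: "\<And>z::complex. z ^ n = 1 \<Longrightarrow> z \<noteq> 1 \<Longrightarrow> ev (Fract [:z:] 1) (Fract [:0,1:] 1) N = 0"
  shows "qint_poly n dvd N"
proof -
  let ?P = "qint_poly n" and ?a = "Fract [:0,1:] 1 :: complex poly fract"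
  have coeff: "coeff ?P i = (if i < n then 1 else 0)" for i
    by (auto simp: qint_poly_def qv_power coeff_sum)
  have deg: "degree ?P = n - 1"
    using n by (intro antisym degree_le le_degree) (auto simp: coeff)
  have lc: "lead_coeff ?P = 1" using n by (simp add: deg coeff)
  then have P0: "?P \<noteq> 0" by auto
  \<comment> \<open>Leading coefficient 1 makes this an ordinary division with remainder.\<close>
  obtain Q R where QR: "pseudo_divmod N ?P = (Q, R)" by fastforce
  have eq: "N = ?P * Q + R" and R: "R = 0 \<or> degree R < n - 1"
    using pseudo_divmod[OF P0 QR] deg lc by simp_all
  \<comment> \<open>The embedding of Z[a] into C(a).\<close>
  define h where "h = (\<lambda>c. poly (map_poly of_int c) ?a)"
  have h: "h c = 0 \<Longrightarrow> c = 0" for c :: "int poly"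
  proof -
    assume "h c = 0"
    have "(of_int c :: complex poly fract) = Fract [:of_int c:] 1" for c
      by (cases c) (simp_all add: of_nat_fract Zero_fract_def One_fract_def of_nat_poly one_pCons)
    then have "h c = Fract (map_poly of_int c) 1"
      unfolding h_def by (induction c) (simp_all add: map_poly_pCons Zero_fract_def)
    with \<open>h c = 0\<close> have "map_poly of_int c = (0 :: complex poly)"
      by (simp add: Zero_fract_def eq_fract)
    then have "of_int (coeff c i) = (0 :: complex)" for i
      by (metis coeff_map_poly coeff_0 of_int_0)
    then show "c = 0" by (intro poly_eqI) simp
  qed
  have h0: "h 0 = 0" by (simp add: h_def)
  define Z where "Z = {z::complex. z ^ n = 1} - {1}"
  have "card Z = n - 1"
    using n by (simp add: Z_def card_roots_unity_eq finite_roots_unity)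
  moreover have inj: "inj_on (\<lambda>z. Fract [:z:] 1) Z"
    by (auto intro!: inj_onI simp: eq_fract)
  ultimately have card: "card ((\<lambda>z. Fract [:z:] 1) ` Z) = n - 1"
    by (simp add: card_image)
  have "R = 0"
  proof (rule ccontr)
    assume R0: "R \<noteq> 0"
    then have R': "map_poly h R \<noteq> 0"
      by (metis coeff_map_poly coeff_0 h h0 leading_coeff_0_iff)
    have "(\<lambda>z. Fract [:z:] 1) ` Z \<subseteq> {x. poly (map_poly h R) x = 0}"
    proof safe
      fix z assume "z \<in> Z"
      then have z: "z ^ n = 1" "z \<noteq> 1" by (auto simp: Z_def)
      have "Fract [:z:] 1 ^ k = Fract [:z ^ k:] 1" for k
        by (induction k) (simp_all add: One_fract_def one_pCons mult.commute)
      then have "Fract [:z:] 1 ^ n = 1" using z(1) by (simp add: One_fract_def one_pCons)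
      \<comment> \<open>(1 - z) [n](z) = 1 - z^n = 0.\<close>
      then have "(1 - Fract [:z:] 1) * ev (Fract [:z:] 1) ?a ?P = 0"
        by (simp only: qint_poly_def ev.hom_sum ev.hom_power ev_qv one_diff_power_eq[symmetric]) simp
      moreover have "1 - Fract [:z:] 1 \<noteq> 0"
        using z(2) by (simp add: Zero_fract_def One_fract_def eq_fract one_pCons)
      ultimately have "ev (Fract [:z:] 1) ?a ?P = 0" by simp
      with N[OF z] have "ev (Fract [:z:] 1) ?a R = 0" by (simp add: eq)
      then show "poly (map_poly h R) (Fract [:z:] 1) = 0" by (simp add: ev_def h_def)
    qed
    then have "n - 1 \<le> card {x. poly (map_poly h R) x = 0}"
      using card poly_roots_finite[OF R'] card_mono by metis
    also have "\<dots> \<le> degree (map_poly h R)" by (rule card_poly_roots_bound[OF R'])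
    also have "\<dots> \<le> degree R" by (intro degree_le) (simp add: coeff_map_poly h0 coeff_eq_0)
    finally show False using R R0 by simp
  qed
  with eq show ?thesis by simp
qed

section \<open>A terminating very-well-poised sum\<close>

text \<open>The summand of the \<open>6\<phi>5\<close> series in base \<open>p\<close> with parameters \<open>q; q, d, p\<^sup>-\<^sup>M\<close>, written without
  negative powers of \<open>p\<close>.\<close>

definition sixphi :: "'a::field \<Rightarrow> 'a \<Rightarrow> 'a \<Rightarrow> nat \<Rightarrow> nat \<Rightarrow> 'a" where
  "sixphi q p d M k = (1 - q * p ^ (2 * k)) / (1 - q) *
     (\<Prod>j<k. (1 - q * p ^ j)\<^sup>2 * (1 - d * p ^ j) * (p ^ M - p ^ j) * p /
       ((1 - p ^ Suc j)\<^sup>2 * (d - q * p ^ Suc j) * (1 - q * p ^ Suc (M + j))))"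

text \<open>The WZ equation after clearing denominators, with \<open>y = p\<^sup>k\<close> and \<open>v = p\<^sup>M\<^sup>+\<^sup>1\<close>.\<close>

lemma wz_identity:
  fixes q d v y :: "'a::comm_ring_1"
  shows "(1 - q * y\<^sup>2) * (y * (1 - v)\<^sup>2 * (d - q * v) + (d - v) * (v - y) * (1 - q * v * y))
    = - v * ((1 - q * y)\<^sup>2 * (1 - d * y) * (v - y) - (1 - y)\<^sup>2 * (d - q * y) * (1 - q * v * y))"
  by (simp add: algebra_simps power2_eq_square)

text \<open>WZ proof: \<open>lam\<close> is the quotient of the right sides at \<open>M + 1\<close>
  and \<open>M\<close>, and the summand at \<open>M + 1\<close> minus \<open>lam\<close> times the
  one at \<open>M\<close> is a difference in \<open>k\<close>, whose sum telescopes to 0.\<close>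

lemma sum_sixphi:
  fixes q p d :: "'a::field"
  assumes p0: "p \<noteq> 0" and p: "\<And>j. p ^ Suc j \<noteq> 1" and q: "\<And>j. q * p ^ j \<noteq> 1"
    and d: "\<And>j. d \<noteq> q * p ^ Suc j"
  shows "(\<Sum>k\<le>M. sixphi q p d M k)
    = (\<Prod>i<M. (1 - q * p ^ Suc i) * (d - p ^ Suc i) / ((1 - p ^ Suc i) * (d - q * p ^ Suc i)))"
proof (induction M)
  case 0
  have "q \<noteq> 1" using q[of 0] by simp
  then show ?case by (simp add: sixphi_def)
next
  case (Suc M)
  define v where "v = p ^ Suc M"
  \<comment> \<open>\<open>C\<close> holds the factors free of \<open>M\<close>, \<open>E\<close>
    those with \<open>v = p ^ Suc M\<close>; both summands are simple multiples of
    \<open>C k * E k\<close>.\<close>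
  define C where "C k = (\<Prod>j<k. (1 - q * p ^ j)\<^sup>2 * (1 - d * p ^ j) * p /
       ((1 - p ^ Suc j)\<^sup>2 * (d - q * p ^ Suc j)))" for k
  define E where "E k = (\<Prod>j<k. (v - p ^ j) / (1 - q * v * p ^ j))" for k
  define lam where "lam = (1 - q * v) * (d - v) / ((1 - v) * (d - q * v))"
  \<comment> \<open>The constant of the WZ certificate that appears in
    \<open>partial\<close>.\<close>
  define alpha where "alpha = - ((1 - q * v) * v / ((1 - q) * (1 - v)\<^sup>2 * (d - q * v)))"
  have q1: "1 - q \<noteq> 0" using q[of 0] by simp
  have v1: "1 - v \<noteq> 0" using p[of M] by (simp add: v_def)
  have v1': "v - 1 \<noteq> 0" using v1 by simp
  have dv: "d - q * v \<noteq> 0" using d[of M] by (simp add: v_def)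
  have qv: "1 - q * v * p ^ k \<noteq> 0" for k
    using q[of "Suc M + k"] by (simp add: v_def power_add mult.assoc)
  have p1: "1 - p ^ Suc k \<noteq> 0" for k using p[of k] by simp
  have dp: "d - q * p ^ Suc k \<noteq> 0" for k using d[of k] by simp
  \<comment> \<open>Here the denominators are those of \<open>E\<close> shifted by one index; the
    shift telescopes to two end factors.\<close>
  have T1: "sixphi q p d (Suc M) k
      = (1 - q * (p ^ k)\<^sup>2) / (1 - q) * (C k * E k * (1 - q * v) / (1 - q * v * p ^ k))" for k
  proof -
    have "(\<Prod>j<k. (1 - q * p ^ j)\<^sup>2 * (1 - d * p ^ j) * (v - p ^ j) * p /
       ((1 - p ^ Suc j)\<^sup>2 * (d - q * p ^ Suc j) * (1 - q * v * p ^ Suc j)))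
      = C k * E k * (1 - q * v) / (1 - q * v * p ^ k)"
    proof (induction k)
      case 0
      show ?case using qv[of 0] by (simp add: C_def E_def)
    next
      case (Suc k)
      have "C (Suc k) * E (Suc k) * (1 - q * v) / (1 - q * v * p ^ Suc k)
        = C k * E k * (1 - q * v) / (1 - q * v * p ^ k) *
         ((1 - q * p ^ k)\<^sup>2 * (1 - d * p ^ k) * (v - p ^ k) * p /
       ((1 - p ^ Suc k)\<^sup>2 * (d - q * p ^ Suc k) * (1 - q * v * p ^ Suc k)))"
        unfolding C_def E_def prod.lessThan_Suc times_divide_times_eq times_divide_eq_right
          times_divide_eq_left divide_divide_eq_left divide_divide_eq_right
        by (simp only: ac_simps)
      then show ?case using Suc by simp
    qed
    then show ?thesis
      by (simp add: sixphi_def v_def power_mult power_add power2_eq_square power_mult_distrib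
         mult_2 ac_simps)
  qed
  \<comment> \<open>Here the numerators are shifted:
    \<open>(p ^ M - p ^ j) * p = v - p ^ Suc j\<close>.\<close>
  have T0: "sixphi q p d M k
      = (1 - q * (p ^ k)\<^sup>2) / (1 - q) * (C k * E k * (v - p ^ k) / ((v - 1) * p ^ k))" for k
  proof -
    have "(\<Prod>j<k. (1 - q * p ^ j)\<^sup>2 * (1 - d * p ^ j) * (p ^ M - p ^ j) * p /
       ((1 - p ^ Suc j)\<^sup>2 * (d - q * p ^ Suc j) * (1 - q * v * p ^ j)))
      = C k * E k * (v - p ^ k) / ((v - 1) * p ^ k)"
    proof (induction k)
      case 0
      show ?case using v1' by (simp add: C_def E_def)
    next
      case (Suc k)
      have "p ^ M - p ^ k = (v - p ^ Suc k) / p" using p0 by (simp add: v_def field_simps)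
      moreover have "(\<Prod>j<Suc k. f j * (p ^ M - p ^ j) * p / (g j * h j)) = P * (vp / p) * fk * p / (gk * hk)"
        if "(\<Prod>j<k. f j * (p ^ M - p ^ j) * p / (g j * h j)) = P" "f k = fk" "g k = gk" "h k = hk" "p ^ M - p ^ k = vp / p"
        for f g h P fk gk hk vp
        using that by simp
      ultimately show ?case using Suc p0
        by (simp add: C_def E_def ac_simps)
    qed
    then show ?thesis
      by (simp add: sixphi_def v_def power_mult power_add power2_eq_square power_mult_distrib
         mult_2 ac_simps)
  qed
  \<comment> \<open>\<open>wz_identity\<close> in quotient form, with \<open>y = p ^ k\<close> and
    the common factor \<open>C k * E k\<close> left out.\<close>
  have step: "(1 - q * y\<^sup>2) / (1 - q) * ((1 - q * v) / (1 - q * v * y))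
      - lam * ((1 - q * y\<^sup>2) / (1 - q) * ((v - y) / ((v - 1) * y)))
     = alpha * ((1 - q * y)\<^sup>2 * (1 - d * y) * (v - y) / (1 - q * v * y) - (1 - y)\<^sup>2 * (d - q * y)) / y"
    if y: "y \<noteq> 0" "1 - q * v * y \<noteq> 0" for y
  proof -
    have "(1 - q * y\<^sup>2) / (1 - q) * ((1 - q * v) / (1 - q * v * y))
      - lam * ((1 - q * y\<^sup>2) / (1 - q) * ((v - y) / ((v - 1) * y)))
      = (1 - q * v) / ((1 - q) * (1 - v)\<^sup>2 * (d - q * v) * y * (1 - q * v * y)) *
       ((1 - q * y\<^sup>2) * (y * (1 - v)\<^sup>2 * (d - q * v) + (d - v) * (v - y) * (1 - q * v * y)))"
    proof -
      have "(v - y) / ((v - 1) * y) = - ((v - y) / ((1 - v) * y))"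
        by (metis minus_diff_eq minus_divide_right mult_minus_left)
      moreover have "a / q1 * (b / w) + b * dd / (v1 * dv) * (a / q1 * (vy / (v1 * y)))
         = b / (q1 * v1\<^sup>2 * dv * y * w) * (a * (y * v1\<^sup>2 * dv + dd * vy * w))"
        if "q1 \<noteq> 0" "w \<noteq> 0" "v1 \<noteq> 0" "dv \<noteq> 0" "y \<noteq> 0" for a b q1 w dd v1 dv vy y :: 'a
        using that by (simp add: divide_simps power2_eq_square) (simp add: algebra_simps)
      ultimately show ?thesis using q1 v1 dv y by (simp add: lam_def)
    qed
    also have "\<dots> = alpha * ((1 - q * y)\<^sup>2 * (1 - d * y) * (v - y) / (1 - q * v * y) - (1 - y)\<^sup>2 * (d - q * y)) / y"
    proof -
      have "b / (q1 * v1 * dv * y * w) * (- v * (X - Y * w)) = - (b * v / (q1 * v1 * dv)) * (X / w - Y) / y"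
        if "q1 \<noteq> 0" "w \<noteq> 0" "v1 \<noteq> 0" "dv \<noteq> 0" "y \<noteq> 0" for b q1 w v1 dv y X Y :: 'a
        using that by (simp add: divide_simps)
      from this[of "1 - q" "1 - q * v * y" "(1 - v)\<^sup>2" "d - q * v" y "1 - q * v"
         "(1 - q * y)\<^sup>2 * (1 - d * y) * (v - y)" "(1 - y)\<^sup>2 * (d - q * y)"]
      show ?thesis using q1 v1 dv y unfolding wz_identity alpha_def by simp
    qed
    finally show ?thesis .
  qed
  \<comment> \<open>The partial sums equal the WZ certificate, which is 0 at
    \<open>k = 0\<close>.\<close>
  have partial: "(\<Sum>i<k. sixphi q p d (Suc M) i - lam * sixphi q p d M i)
     = alpha * (C k * E k) * ((1 - p ^ k)\<^sup>2 * (d - q * p ^ k)) / p ^ k" for k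
  proof (induction k)
    case (Suc k)
    have "sixphi q p d (Suc M) k - lam * sixphi q p d M k
      = C k * E k * ((1 - q * (p ^ k)\<^sup>2) / (1 - q) * ((1 - q * v) / (1 - q * v * p ^ k))
      - lam * ((1 - q * (p ^ k)\<^sup>2) / (1 - q) * ((v - p ^ k) / ((v - 1) * p ^ k))))"
    proof -
      have "a * (c * n1 / d1) - l * (a * (c * n2 / d2)) = c * (a * (n1 / d1) - l * (a * (n2 / d2)))"
        for a c n1 d1 l n2 d2 :: 'a
        by (simp add: right_diff_distrib ac_simps)
      then show ?thesis unfolding T0 T1 .
    qed
    also have "\<dots> = C k * E k * (alpha * ((1 - q * p ^ k)\<^sup>2 * (1 - d * p ^ k) * (v - p ^ k) / (1 - q * v * p ^ k)
       - (1 - p ^ k)\<^sup>2 * (d - q * p ^ k)) / p ^ k)"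
      using p0 qv by (subst step) auto
    moreover have "alpha * ce * (P * D) / y + ce * (alpha * (X - P * D) / y) = ce * alpha * X / y"
      for ce P D X y :: 'a
      by (simp add: algebra_simps diff_divide_distrib)
    ultimately have "(\<Sum>i<Suc k. sixphi q p d (Suc M) i - lam * sixphi q p d M i)
       = C k * E k * alpha * ((1 - q * p ^ k)\<^sup>2 * (1 - d * p ^ k) * (v - p ^ k) / (1 - q * v * p ^ k)) / p ^ k"
      unfolding sum.lessThan_Suc Suc.IH by simp
    moreover have "C (Suc k) = C k * ((1 - q * p ^ k)\<^sup>2 * (1 - d * p ^ k) * p /
       ((1 - p ^ Suc k)\<^sup>2 * (d - q * p ^ Suc k)))"
      "E (Suc k) = E k * ((v - p ^ k) / (1 - q * v * p ^ k))"
      by (simp_all add: C_def E_def)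
    moreover have "ce * al * (q2 * dd * vp / w) / y
       = al * (c * (q2 * dd * p / (p2 * dq)) * (e * (vp / w))) * (p2 * dq) / (p * y)"
       if "ce = c * e" "p2 \<noteq> 0" "dq \<noteq> 0" for ce al q2 dd vp w y c e p2 dq
       using that p0 by simp
    ultimately show ?case using p1[of k] dp[of k] p0 by (simp add: power2_eq_square)
  qed simp
  \<comment> \<open>The factor of index \<open>M + 1\<close> is \<open>v - p ^ Suc M = 0\<close>, so
    the certificate ends at 0.\<close>
  have "E (Suc (Suc M)) = 0" by (auto simp: E_def v_def)
  with partial[of "Suc (Suc M)"]
  have "(\<Sum>i<Suc (Suc M). sixphi q p d (Suc M) i) = lam * (\<Sum>i<Suc (Suc M). sixphi q p d M i)"
    by (simp add: sum_subtractf sum_distrib_left del: sum.lessThan_Suc)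
  \<comment> \<open>The extra term at \<open>k = M + 1\<close> is 0 by the factor
    \<open>v - p ^ k\<close> in \<open>T0\<close>.\<close>
  also have "(\<Sum>i<Suc (Suc M). sixphi q p d M i) = (\<Sum>i\<le>M. sixphi q p d M i)"
    by (simp add: T0[of "Suc M"] v_def lessThan_Suc_atMost)
  finally show ?case
    unfolding Suc.IH prod.lessThan_Suc by (simp add: lam_def v_def lessThan_Suc_atMost)
qed

text \<open>The k-th term of the theorem for q = \<open>x\<close> in any field. The squared quotient
  stands apart: at a nontrivial root of unity, only its denominators can vanish while a is
  generic.\<close>

definition summand :: "'a::field \<Rightarrow> 'a \<Rightarrow> nat \<Rightarrow> 'a" where
  "summand x a k = (1 - x ^ (8 * k + 1)) / (1 - x) * x ^ (2 * k) *
     (\<Prod>j<k. (1 - x ^ (4 * j + 1)) / (1 - x ^ (4 * j + 4)))\<^sup>2 *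
     (\<Prod>j<k. (1 - a * x ^ (4 * j + 1)) * (1 - x ^ (4 * j + 1) / a) /
        ((1 - a * x ^ (4 * j + 4)) * (1 - x ^ (4 * j + 4) / a)))"

text \<open>The case a = 1 / q^n thus reduces to a = q^n.\<close>

lemma summand_inverse: "a \<noteq> 0 \<Longrightarrow> summand x (1 / a) k = summand x a k"
  by (simp add: summand_def mult.commute)

lemma rq_power_eq_iff: "rq ^ i = rq ^ j \<longleftrightarrow> i = j"
proof
  assume *: "rq ^ i = rq ^ j"
  have "rq ^ k = Fract (monom 1 k) 1" for k
  proof -
    have "rq ^ k = Fract (qv ^ k) 1" by (induction k) (simp_all add: rq_def One_fract_def)
    then show ?thesis by (simp add: qv_power)
  qed
  with * have "monom 1 i = (monom 1 j :: int poly poly)" by (simp add: eq_fract)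
  then show "i = j" by (metis degree_monom_eq zero_neq_one)
qed simp

lemma rq_power_neq_1 [simp]: "0 < i \<Longrightarrow> rq ^ i \<noteq> 1"
  using rq_power_eq_iff[of i 0] by simp

lemma rq_neq_0 [simp]: "rq \<noteq> 0" and rq_neq_1 [simp]: "rq \<noteq> 1"
  using rq_power_eq_iff[of 1 2] rq_power_neq_1[of 1] by auto

text \<open>At a = q^n with n = 4M + 1 the factor 1 - q^(4j+1) / a vanishes for j = M, and the terms
  are those of \<open>sixphi\<close> in base q^4. Reversing two products brings its closed form into
  the stated one.\<close>

lemma sum_summand_power:
  fixes q :: "'a::field"
  assumes q: "\<And>i j. q ^ i = q ^ j \<longleftrightarrow> i = j" and q0: "q \<noteq> 0"
  shows "(\<Sum>k\<le>M. summand q (q ^ (4 * M + 1)) k)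
    = (\<Prod>j<M. (1 - q ^ (4 * j + 2)) / (1 - q ^ (4 * j + 4))) * ((1 - q ^ (4 * M + 1)) / (1 - q)) * inverse (q ^ M)"
proof -
  define p where "p = q ^ 4"
  \<comment> \<open>This is aq at a = q^(4M+1).\<close>
  define d where "d = q ^ 2 * p ^ M"
  have pw: "q ^ (4 * j + i) = q ^ i * p ^ j" for i j
    by (simp only: p_def power_add power_mult) (rule mult.commute)
  have p0: "p \<noteq> 0" using q0 by (simp add: p_def)
  have q1: "q ^ i \<noteq> 1" if "0 < i" for i using q[of i 0] that by simp
  have q11: "1 - q \<noteq> 0" using q1[of 1] by simp
  have hp: "p ^ Suc j \<noteq> 1" for j
    unfolding p_def power_mult[symmetric] by (rule q1) simp
  have hq: "q * p ^ j \<noteq> 1" for j using q1[of "4 * j + 1", unfolded pw] by simp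
  have hd: "d \<noteq> q * p ^ Suc j" for j
  proof -
    have "4 * M + 2 \<noteq> 4 * Suc j + 1" by presburger
    then have "q ^ (4 * M + 2) \<noteq> q ^ (4 * Suc j + 1)" by (simp only: q) simp
    then show ?thesis by (simp only: pw d_def) simp
  qed
  have "summand q (q ^ (4 * M + 1)) k = sixphi q p d M k" for k
  proof -
    \<comment> \<open>Spreading q^(2k) over the \<open>k\<close> factors allows a factorwise
      comparison.\<close>
    have pk: "q ^ (2 * k) = (\<Prod>j<k. q ^ 2)" by (simp add: power_mult)
    have "q ^ (2 * k) * (\<Prod>j<k. (1 - q ^ (4 * j + 1)) / (1 - q ^ (4 * j + 4)))\<^sup>2 *
     (\<Prod>j<k. (1 - q ^ (4 * M + 1) * q ^ (4 * j + 1)) * (1 - q ^ (4 * j + 1) / q ^ (4 * M + 1)) /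
        ((1 - q ^ (4 * M + 1) * q ^ (4 * j + 4)) * (1 - q ^ (4 * j + 4) / q ^ (4 * M + 1))))
      = (\<Prod>j<k. (1 - q * p ^ j)\<^sup>2 * (1 - d * p ^ j) * (p ^ M - p ^ j) * p /
       ((1 - p ^ Suc j)\<^sup>2 * (d - q * p ^ Suc j) * (1 - q * p ^ Suc (M + j))))"
      unfolding pk prod_power_distrib prod.distrib[symmetric]
    proof (rule prod.cong[OF refl])
      fix j
      have 1: "1 - q ^ (4 * j + 1) / q ^ (4 * M + 1) = (p ^ M - p ^ j) / p ^ M"
        unfolding pw using q0 p0 by (simp add: field_simps)
      have 2: "1 - q ^ (4 * j + 4) / q ^ (4 * M + 1) = (d - q * p ^ Suc j) / d"
        unfolding pw d_def using q0 p0 by (simp add: field_simps p_def power2_eq_square)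
      have 3: "1 - q ^ (4 * M + 1) * q ^ (4 * j + 1) = 1 - d * p ^ j"
        unfolding pw d_def by (simp add: power2_eq_square ac_simps)
      have 4: "1 - q ^ (4 * M + 1) * q ^ (4 * j + 4) = 1 - q * p ^ Suc (M + j)"
        unfolding pw by (simp add: p_def[symmetric] power_add ac_simps)
      have 5: "q ^ (4 * j + 4) = p ^ Suc j" unfolding pw by (simp add: p_def)
      have 6: "q ^ (4 * j + 1) = q * p ^ j" unfolding pw by simp
      \<comment> \<open>The denominators of \<open>1\<close> and \<open>2\<close> leave
        \<open>d / p ^ M\<close>, which together with q^2 is the factor \<open>p\<close> of
        \<open>sixphi\<close>.\<close>
      have p: "p = q\<^sup>2 * (d / p ^ M)"
        using p0 unfolding d_def by (simp add: p_def power2_eq_square eval_nat_numeral ac_simps)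
      have d0: "d \<noteq> 0" using q0 p0 by (simp add: d_def)
      show "q\<^sup>2 * ((1 - q ^ (4 * j + 1)) / (1 - q ^ (4 * j + 4)))\<^sup>2 *
         ((1 - q ^ (4 * M + 1) * q ^ (4 * j + 1)) * (1 - q ^ (4 * j + 1) / q ^ (4 * M + 1)) /
          ((1 - q ^ (4 * M + 1) * q ^ (4 * j + 4)) * (1 - q ^ (4 * j + 4) / q ^ (4 * M + 1))))
        = (1 - q * p ^ j)\<^sup>2 * (1 - d * p ^ j) * (p ^ M - p ^ j) * p /
       ((1 - p ^ Suc j)\<^sup>2 * (d - q * p ^ Suc j) * (1 - q * p ^ Suc (M + j)))"
        unfolding 1 2 3 4 unfolding 5 6
        by (subst (7) p) (simp add: power_divide ac_simps)
    qed
    moreover have "q ^ (8 * k + 1) = q * p ^ (2 * k)"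
      using pw[of "2 * k" 1] by simp
    ultimately show ?thesis unfolding summand_def sixphi_def by (simp only: mult.assoc)
  qed
  then have "(\<Sum>k\<le>M. summand q (q ^ (4 * M + 1)) k)
    = (\<Prod>i<M. (1 - q * p ^ Suc i) * (d - p ^ Suc i) / ((1 - p ^ Suc i) * (d - q * p ^ Suc i)))"
    using sum_sixphi[OF p0 hp hq hd] by simp
  also have "\<dots> = (\<Prod>i<M. 1 - q * p ^ Suc i) * (\<Prod>i<M. d - p ^ Suc i) /
      ((\<Prod>i<M. 1 - p ^ Suc i) * (\<Prod>i<M. d - q * p ^ Suc i))"
    by (simp add: prod_dividef prod.distrib)
  \<comment> \<open>Index reversal. This product and the next one yield the same powers of
    \<open>p\<close> and the same sign, which cancel; the next one also yields q^M.\<close>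
  also have "(\<Prod>i<M. d - p ^ Suc i) = (\<Prod>i<M. p ^ (M - i) * (q\<^sup>2 * p ^ i - 1))"
  proof (subst prod.nat_diff_reindex[symmetric], rule prod.cong[OF refl])
    fix i assume "i \<in> {..<M}"
    then have "Suc (M - Suc i) = M - i" "p ^ M = p ^ (M - i) * p ^ i"
      by (simp_all add: power_add[symmetric])
    then show "d - p ^ Suc (M - Suc i) = p ^ (M - i) * (q\<^sup>2 * p ^ i - 1)"
      by (simp add: d_def algebra_simps del: power_Suc)
  qed
  also have "(\<Prod>i<M. d - q * p ^ Suc i) = (\<Prod>i<M. p ^ (M - i) * (q * (q * p ^ i - 1)))"
  proof (subst prod.nat_diff_reindex[symmetric], rule prod.cong[OF refl])
    fix i assume "i \<in> {..<M}"
    then have "Suc (M - Suc i) = M - i" "p ^ M = p ^ (M - i) * p ^ i"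
      by (simp_all add: power_add[symmetric])
    then show "d - q * p ^ Suc (M - Suc i) = p ^ (M - i) * (q * (q * p ^ i - 1))"
      by (simp add: d_def algebra_simps power2_eq_square del: power_Suc)
  qed
  also have "(\<Prod>i<M. p ^ (M - i) * (q\<^sup>2 * p ^ i - 1))
     = (\<Prod>i<M. p ^ (M - i)) * (-1) ^ M * (\<Prod>i<M. 1 - q\<^sup>2 * p ^ i)"
  proof -
    have "(\<Prod>i<M. q\<^sup>2 * p ^ i - 1) = (\<Prod>i<M. (-1) * (1 - q\<^sup>2 * p ^ i))" by simp
    then show ?thesis unfolding prod.distrib by simp
  qed
  also have "(\<Prod>i<M. p ^ (M - i) * (q * (q * p ^ i - 1)))
     = (\<Prod>i<M. p ^ (M - i)) * (-1) ^ M * (q ^ M * (\<Prod>i<M. 1 - q * p ^ i))"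
  proof -
    have "(\<Prod>i<M. q * p ^ i - 1) = (\<Prod>i<M. (-1) * (1 - q * p ^ i))" by simp
    then show ?thesis unfolding prod.distrib by simp
  qed
  \<comment> \<open>The shift by one index leaves (1 - q^n) / (1 - q) with n = 4M + 1.\<close>
  also have "(\<Prod>i<M. 1 - q * p ^ Suc i) = (\<Prod>i<M. 1 - q * p ^ i) * ((1 - q * p ^ M) / (1 - q))"
  proof (induction M)
    case 0 show ?case using q11 by simp
  next
    case (Suc M)
    have "1 - q * p ^ M \<noteq> 0" using hq[of M] by simp
    then show ?case unfolding prod.lessThan_Suc Suc.IH by simp
  qed
  also have "A * (z / w) * (B * s * C) / (D * (B * s * (Q * A))) = C / D * (z / w) / Q"
    if "A \<noteq> 0" "B \<noteq> 0" "s \<noteq> 0" for A B C D Q s z w :: 'a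
    using that by (simp add: ac_simps)
  finally have "(\<Sum>k\<le>M. summand q (q ^ (4 * M + 1)) k)
    = (\<Prod>i<M. 1 - q\<^sup>2 * p ^ i) / (\<Prod>i<M. 1 - p ^ Suc i) * ((1 - q * p ^ M) / (1 - q)) / q ^ M"
    using p0 hq by simp
  then show ?thesis
    unfolding prod_dividef pw by (simp add: p_def divide_inverse[of _ "q ^ M"])
qed

section \<open>Roots of unity\<close>

text \<open>Terms \<open>s\<close> and \<open>e - s\<close> cancel: x^(4j+4) and x^(4(e-1-j)+1) are
  inverse to each other, and \<open>NN\<close>, the four factors with equal exponent, is reciprocal
  up to z^4.\<close>

lemma antisymmetric_block_sum:
  fixes x y :: "'a::field"
  assumes two: "(2::'a) \<noteq> 0" and x: "x ^ (4 * e + 1) = 1"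
  defines "NN \<equiv> \<lambda>z. (1 - z)\<^sup>2 * (1 - y * z) * (1 - z / y)"
  defines "F \<equiv> \<lambda>s. \<Prod>j<s. NN (x ^ (4 * j + 1)) / NN (x ^ (4 * j + 4))"
  assumes y: "y \<noteq> 0"
    and nz: "\<And>j. j < e \<Longrightarrow> NN (x ^ (4 * j + 4)) \<noteq> 0"
  shows "(\<Sum>s\<le>e. (1 - x ^ (8 * s + 1)) * x ^ (2 * s) * F s) = 0"
proof -
  have x0: "x \<noteq> 0" using x by (metis power_0_left add_is_0 one_neq_zero zero_neq_one)
  have xp: "x ^ (k * (4 * e + 1)) = 1" for k
    by (metis mult.commute power_mult power_one x)
  \<comment> \<open>One power of z goes to each of the four factors; those with \<open>y\<close> and
    \<open>1 / y\<close> change places.\<close>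
  have NN_recip: "NN z = z ^ 4 * NN z'" if "z * z' = 1" for z z'
  proof -
    have "z ^ 4 * NN z' = (z * (1 - z'))\<^sup>2 * (z * (1 - y * z')) * (z * (1 - z' / y))"
      by (simp add: NN_def power2_eq_square eval_nat_numeral ac_simps)
    also have "z * (1 - z') = z - 1"
      using that by (simp add: right_diff_distrib)
    also have "z * (1 - y * z') = z - y"
      using that by (simp add: right_diff_distrib mult.left_commute)
    also have "z * (1 - z' / y) = z - 1 / y"
      using that by (simp add: right_diff_distrib)
    also have "(z - 1)\<^sup>2 * (z - y) * (z - 1 / y) = NN z"
      using y by (simp add: NN_def field_simps power2_eq_square)
    finally show ?thesis by simp
  qed
  have num: "NN (x ^ (4 * j + 4)) = x ^ (4 * (4 * j + 4)) * NN (x ^ (4 * (e - Suc j) + 1))"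
     if "j < e" for j
  proof -
    have "4 * j + 4 + (4 * (e - Suc j) + 1) = 4 * e + 1" using that by simp
    then have "x ^ (4 * j + 4) * x ^ (4 * (e - Suc j) + 1) = 1"
      using x by (metis power_add)
    from NN_recip[OF this] show ?thesis by (simp only: power_mult[symmetric] mult.commute[of _ 4])
  qed
  have den: "NN (x ^ (4 * j + 1)) = x ^ (4 * (4 * j + 1)) * NN (x ^ (4 * (e - Suc j) + 4))"
     if "j < e" for j
  proof -
    have "4 * j + 1 + (4 * (e - Suc j) + 4) = 4 * e + 1" using that by simp
    then have "x ^ (4 * j + 1) * x ^ (4 * (e - Suc j) + 4) = 1"
      using x by (metis power_add)
    from NN_recip[OF this] show ?thesis by (simp only: power_mult[symmetric] mult.commute[of _ 4])
  qed
  have nz': "NN (x ^ (4 * j + 1)) \<noteq> 0" if "j < e" for j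
    using den[OF that] nz[of "e - Suc j"] that x0 by simp
  \<comment> \<open>The weights x^(4(4s+4)) and x^(4(4s+1)) from \<open>num\<close> and
    \<open>den\<close> differ by the factor x^12, once per step.\<close>
  have F_refl: "F (e - s) = F e * F s * x ^ (12 * s)" if "s \<le> e" for s
    using that
  proof (induction s)
    case 0 show ?case by (simp add: F_def)
  next
    case (Suc s)
    then have s: "s < e" by simp
    have "e - s = Suc (e - Suc s)" using s by simp
    then have "F (e - s) = F (e - Suc s) * (NN (x ^ (4 * (e - Suc s) + 1)) / NN (x ^ (4 * (e - Suc s) + 4)))"
      by (simp add: F_def)
    moreover have "F (Suc s) = F s * (NN (x ^ (4 * s + 1)) / NN (x ^ (4 * s + 4)))"
      by (simp add: F_def)
    moreover have "F (e - s) = F e * F s * x ^ (12 * s)" using Suc by simp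
    moreover have "4 * (4 * s + 4) = 12 + 4 * (4 * s + 1)" by simp
    then have "x ^ (4 * (4 * s + 4)) = x ^ 12 * x ^ (4 * (4 * s + 1))"
      by (metis power_add)
    moreover have "x ^ (12 * Suc s) = x ^ 12 * x ^ (12 * s)"
      by (simp add: power_add[symmetric])
    moreover have "NN (x ^ (4 * (e - Suc s) + 1)) \<noteq> 0" "NN (x ^ (4 * (e - Suc s) + 4)) \<noteq> 0"
      using nz nz' s by simp_all
    moreover note num[OF s] den[OF s]
    moreover have "F' = Fe * F1 * (z * w)"
      if "E = F' * (a / b)" "F1 = Fs * (X * b / (z * X * a))" "E = Fe * Fs * w"
        "a \<noteq> 0" "b \<noteq> 0" "X \<noteq> 0" "z \<noteq> 0" for F' E a b F1 Fs X z w Fe :: 'a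
    proof -
      have "F' = E * (b / a)" using that(1,4,5) by simp
      also have "\<dots> = Fe * F1 * (z * w)" unfolding that(2,3) using that(4-7) by simp
      finally show ?thesis .
    qed
    ultimately show ?case using x0 by simp
  qed
  \<comment> \<open>The weights from \<open>num\<close> multiply to x^(8e(e+1)), and 8e(e+1) +
    2(e+1) is a multiple of 4e + 1.\<close>
  have F_e: "F e = x ^ (2 * (e + 1))"
  proof -
    have "(\<Prod>j<e. NN (x ^ (4 * j + 4))) = (\<Prod>j<e. x ^ (16 * Suc j) * NN (x ^ (4 * (e - Suc j) + 1)))"
      by (rule prod.cong) (use num in \<open>auto simp: algebra_simps\<close>)
    also have "\<dots> = (\<Prod>j<e. x ^ (16 * Suc j)) * (\<Prod>j<e. NN (x ^ (4 * (e - Suc j) + 1)))"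
      by (rule prod.distrib)
    also have "(\<Prod>j<e. NN (x ^ (4 * (e - Suc j) + 1))) = (\<Prod>j<e. NN (x ^ (4 * j + 1)))"
      by (rule prod.nat_diff_reindex)
    also have "(\<Prod>j<e. x ^ (16 * Suc j)) = x ^ (8 * e * (e + 1))"
      by (induction e) (simp_all add: power_add[symmetric] algebra_simps)
    finally have "(\<Prod>j<e. NN (x ^ (4 * j + 4))) = x ^ (8 * e * (e + 1)) * (\<Prod>j<e. NN (x ^ (4 * j + 1)))" .
    moreover have "(\<Prod>j<e. NN (x ^ (4 * j + 4))) \<noteq> 0" using nz by auto
    ultimately have "F e * x ^ (8 * e * (e + 1)) = 1"
      unfolding F_def prod_dividef by (simp add: field_simps)
    moreover have "x ^ (8 * e * (e + 1)) * x ^ (2 * (e + 1)) = 1"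
    proof -
      have "8 * e * (e + 1) + 2 * (e + 1) = (2 * (e + 1)) * (4 * e + 1)" by (simp add: algebra_simps)
      then show ?thesis using xp by (metis power_add)
    qed
    moreover have "f = y" if "f * z = 1" "z * y = 1" for f z y :: 'a
      using that by (metis mult.assoc mult_1 mult.right_neutral)
    ultimately show ?thesis by blast
  qed
  define b where "b s = (1 - x ^ (8 * s + 1)) * x ^ (2 * s) * F s" for s
  have b_refl: "b (e - s) = - b s" if "s \<le> e" for s
  proof -
    have "x ^ (8 * (e - s) + 1) * x ^ (8 * s + 1) = x ^ (2 * (4 * e + 1))"
      using that by (simp add: power_add[symmetric] algebra_simps)
    then have 1: "x ^ (8 * (e - s) + 1) * x ^ (8 * s + 1) = 1" using xp by metis
    \<comment> \<open>The powers collected by reflection equal x^(8s+1) x^(2s); multiplication by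
      the first turns 1 - x^(8(e-s)+1) into x^(8s+1) - 1.\<close>
    have "2 * (e - s) + 2 * (e + 1) + 12 * s = (8 * s + 1) + 2 * s + (4 * e + 1)"
      using that by simp
    then have 2: "x ^ (2 * (e - s)) * x ^ (2 * (e + 1)) * x ^ (12 * s) = x ^ (8 * s + 1) * x ^ (2 * s)"
      using x by (metis power_add mult.right_neutral)
    have "b (e - s) = (1 - x ^ (8 * (e - s) + 1)) * (x ^ (2 * (e - s)) * x ^ (2 * (e + 1)) * x ^ (12 * s)) * F s"
      unfolding b_def F_refl[OF that] F_e by (simp add: ac_simps)
    also have "\<dots> = (x ^ (8 * s + 1) - x ^ (8 * (e - s) + 1) * x ^ (8 * s + 1)) * x ^ (2 * s) * F s"
      unfolding 2 by (simp add: algebra_simps)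
    also have "\<dots> = - b s" unfolding 1 b_def by (simp add: algebra_simps)
    finally show ?thesis .
  qed
  have "(\<Sum>s\<le>e. b s) = (\<Sum>s\<le>e. b (e - s))"
    using sum.nat_diff_reindex[of b "Suc e"] by (simp add: lessThan_Suc_atMost)
  also have "\<dots> = - (\<Sum>s\<le>e. b s)" using b_refl by (simp add: sum_negf)
  finally have "2 * (\<Sum>s\<le>e. b s) = 0" unfolding eq_neg_iff_add_eq_0 mult_2 .
  with two show ?thesis by (simp add: b_def)
qed

text \<open>For the substitutions a = q^n and a = 1 / q^n, where no denominator vanishes.\<close>

lemma hasval_summand:
  fixes x a :: "'b::field"
  assumes "x \<noteq> 1" "a \<noteq> 0"
    and "\<And>j. j < k \<Longrightarrow> x ^ (4 * j + 4) \<noteq> 1"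
    and "\<And>j. j < k \<Longrightarrow> a * x ^ (4 * j + 4) \<noteq> 1"
    and "\<And>j. j < k \<Longrightarrow> x ^ (4 * j + 4) \<noteq> a"
  shows "ev.hasval x a (summand rq ra k) (summand x a k)"
  unfolding summand_def using assms
  by (intro ev.hasval_intros hasval_rq hasval_ra) auto

lemma multiplicative_order:
  fixes x :: "'a::field"
  assumes "x ^ n = 1" "n > 0"
  obtains d where "d > 0" "\<And>i. x ^ i = 1 \<longleftrightarrow> d dvd i"
proof
  define d where "d = (LEAST d. d > 0 \<and> x ^ d = 1)"
  have d: "d > 0" "x ^ d = 1"
    using LeastI[of "\<lambda>d. d > 0 \<and> x ^ d = 1" n] assms by (auto simp: d_def)
  then show "d > 0" by simp
  show "x ^ i = 1 \<longleftrightarrow> d dvd i" for i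
  proof
    assume "x ^ i = 1"
    have "x ^ i = x ^ (d * (i div d) + i mod d)" by simp
    also have "\<dots> = x ^ (i mod d)" using d by (simp only: power_add power_mult) simp
    finally have "x ^ (i mod d) = 1" using \<open>x ^ i = 1\<close> by simp
    with d have "i mod d = 0"
      using not_less_Least[of "i mod d" "\<lambda>d. d > 0 \<and> x ^ d = 1"] by (auto simp: d_def)
    then show "d dvd i" by auto
  qed (auto simp: d power_mult)
qed

lemma power_eq_mod_order:
  fixes x :: "'a::field"
  assumes "x ^ d = 1" shows "x ^ (c * (l * d + s) + t) = x ^ (c * s + t)"
proof -
  have "c * (l * d + s) + t = d * (c * l) + (c * s + t)" by (simp add: algebra_simps)
  then show ?thesis using assms by (simp only: power_add[of _ "d * (c * l)"] power_mult[of _ d]) simp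
qed

text \<open>4 is invertible modulo the odd \<open>d\<close>, so in a block of \<open>d\<close>
  indices only the last one can give a vanishing denominator.\<close>

lemma power_4_Suc_neq_1:
  fixes x :: "'a::field"
  assumes "odd d" and ord: "\<And>i. x ^ i = 1 \<longleftrightarrow> d dvd i" and "Suc j < d"
  shows "x ^ (4 * j + 4) \<noteq> 1"
proof
  assume "x ^ (4 * j + 4) = 1"
  then have "d dvd 2 ^ 2 * Suc j" by (simp add: ord add.commute)
  moreover have "coprime d (2 ^ 2)"
    using \<open>odd d\<close> by (simp only: coprime_power_right_iff coprime_right_2_iff_odd) simp
  ultimately have "d dvd Suc j" using coprime_dvd_mult_right_iff by blast
  then have "d \<le> Suc j" by (rule dvd_imp_le) simp
  with \<open>Suc j < d\<close> show False by simp
qed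

text \<open>In each block of \<open>d\<close> indices, the numerator at position \<open>e\<close>
  and the denominator at position \<open>d - 1\<close> vanish at \<open>x\<close>. Both are
  multiples of 1 - q^d; once it is cancelled, the block has a value. \<open>u l\<close> is the value
  of the first \<open>l\<close> blocks.\<close>

lemma qpoch_ratio_regular:
  fixes x y :: "'b::field" and e t d :: nat
  assumes char: "\<And>m. 0 < m \<Longrightarrow> of_nat m \<noteq> (0::'b)"
    and d: "d > 0" "odd d" and ord: "\<And>i. x ^ i = 1 \<longleftrightarrow> d dvd i"
    and e: "e < d" "d dvd 4 * e + t"
  defines "R \<equiv> \<lambda>k. \<Prod>j<k. (1 - rq ^ (4 * j + t)) / (1 - rq ^ (4 * j + 4))"
  obtains u where "\<And>l s. s < d \<Longrightarrow>
    ev.hasval x y (R (l * d + s)) (u l * (\<Prod>j<s. (1 - x ^ (4 * j + t)) / (1 - x ^ (4 * j + 4))))"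
proof -
  have xd: "x ^ d = 1" using ord[of d] by simp
  note xmod = power_eq_mod_order[OF xd]
  note den = power_4_Suc_neq_1[OF d(2) ord]
  have R_add: "R (k + s) = R k * (\<Prod>j<s. (1 - rq ^ (4 * (k + j) + t)) / (1 - rq ^ (4 * (k + j) + 4)))" for k s
    unfolding R_def by (induction s) simp_all
  \<comment> \<open>An incomplete block stops before position \<open>d - 1\<close>, so none of its
    denominators vanishes.\<close>
  have block: "ev.hasval x y (R (l * d + s)) (v * (\<Prod>j<s. (1 - x ^ (4 * j + t)) / (1 - x ^ (4 * j + 4))))"
    if "ev.hasval x y (R (l * d)) v" "s < d" for l s v
    unfolding R_add
  proof (intro ev.hasval_mult that ev.hasval_prod)
    fix j assume "j \<in> {..<s}"
    then have "x ^ (4 * j + 4) \<noteq> 1" using that den by simp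
    then have "ev.hasval x y ((1 - rq ^ (4 * (l * d + j) + t)) / (1 - rq ^ (4 * (l * d + j) + 4)))
       ((1 - x ^ (4 * (l * d + j) + t)) / (1 - x ^ (4 * (l * d + j) + 4)))"
      by (intro ev.hasval_intros hasval_rq) (simp only: xmod, simp)
    then show "ev.hasval x y ((1 - rq ^ (4 * (l * d + j) + t)) / (1 - rq ^ (4 * (l * d + j) + 4)))
       ((1 - x ^ (4 * j + t)) / (1 - x ^ (4 * j + 4)))" by (simp only: xmod)
  qed
  have "\<exists>v. ev.hasval x y (R (l * d)) v" for l
  proof (induction l)
    case 0
    show ?case using ev.hasval_1 by (auto simp: R_def)
  next
    case (Suc l)
    then obtain v where v: "ev.hasval x y (R (l * d)) v" by blast
    define num where "num j = 1 - rq ^ (4 * (l * d + j) + t)" for j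
    define den where "den j = 1 - rq ^ (4 * (l * d + j) + 4)" for j
    obtain m where m: "4 * (l * d + e) + t = d * m"
    proof -
      have "4 * (l * d + e) + t = d * (4 * l) + (4 * e + t)" by (simp add: algebra_simps)
      then show ?thesis using e(2) that by (metis dvd_add dvd_triv_left dvdE)
    qed
    have m': "4 * (l * d + (d - 1)) + 4 = d * (4 * Suc l)" using d by (simp add: algebra_simps)
    \<comment> \<open>The two vanishing factors are separated from the rest.\<close>
    have "(\<Prod>j<d. num j / den j) = (num e * (\<Prod>j\<in>{..<d} - {e}. num j)) /
        (den (d - 1) * (\<Prod>j\<in>{..<d} - {d - 1}. den j))"
      unfolding prod_dividef using d e prod.remove[of "{..<d}" e num] prod.remove[of "{..<d}" "d - 1" den]
      by simp
    also have "num e = (1 - rq ^ d) * (\<Sum>i<m. (rq ^ d) ^ i)"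
      unfolding num_def m by (simp add: power_mult one_diff_power_eq)
    also have "den (d - 1) = (1 - rq ^ d) * (\<Sum>i<4 * Suc l. (rq ^ d) ^ i)"
      unfolding den_def m' power_mult[of _ d] by (rule one_diff_power_eq)
    finally have eq: "R (Suc l * d) = R (l * d) * (((\<Sum>i<m. (rq ^ d) ^ i) * (\<Prod>j\<in>{..<d} - {e}. num j)) /
        ((\<Sum>i<4 * Suc l. (rq ^ d) ^ i) * (\<Prod>j\<in>{..<d} - {d - 1}. den j)))"
      using R_add[of "l * d" d] d by (simp add: num_def den_def add.commute mult.assoc)
    \<comment> \<open>As x^d = 1, a geometric sum of \<open>k\<close> terms has value
      \<open>k\<close>; in the denominator this is 4(l+1), nonzero by \<open>char\<close>.\<close>
    have hs: "ev.hasval x y (\<Sum>i<k. (rq ^ d) ^ i) (of_nat k)" for k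
    proof -
      have "ev.hasval x y (\<Sum>i<k. (rq ^ d) ^ i) (\<Sum>i<k. (x ^ d) ^ i)"
        by (intro ev.hasval_sum ev.hasval_intros hasval_rq)
      then show ?thesis by (simp add: xd)
    qed
    have hn: "ev.hasval x y (num j) (1 - x ^ (4 * (l * d + j) + t))" for j
      unfolding num_def by (intro ev.hasval_intros hasval_rq)
    have hd: "ev.hasval x y (den j) (1 - x ^ (4 * (l * d + j) + 4))" for j
      unfolding den_def by (intro ev.hasval_intros hasval_rq)
    have "of_nat (4 * Suc l) * (\<Prod>j\<in>{..<d} - {d - 1}. 1 - x ^ (4 * (l * d + j) + 4)) \<noteq> 0"
      using char[of "4 * Suc l"] power_4_Suc_neq_1[OF d(2) ord]
      unfolding xmod by (auto simp del: of_nat_mult of_nat_Suc)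
    then have "ev.hasval x y (R (Suc l * d)) (v * ((of_nat m *
        (\<Prod>j\<in>{..<d} - {e}. 1 - x ^ (4 * (l * d + j) + t))) / (of_nat (4 * Suc l) *
        (\<Prod>j\<in>{..<d} - {d - 1}. 1 - x ^ (4 * (l * d + j) + 4)))))"
      unfolding eq
      by (intro ev.hasval_mult[OF v] ev.hasval_divide ev.hasval_mult[OF hs] ev.hasval_prod hn hd)
    then show ?case by blast
  qed
  then obtain u where "ev.hasval x y (R (l * d)) (u l)" for l by metis
  then show thesis using that block by blast
qed

section \<open>Both sides at a nontrivial n-th root of unity, n = 4M + 1\<close>

context
  fixes x y :: "'b::field" and M :: nat
  assumes char: "\<And>m. 0 < m \<Longrightarrow> of_nat m \<noteq> (0::'b)"
    and x: "x ^ (4 * M + 1) = 1" and x1: "x \<noteq> 1"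
    and y: "y \<noteq> 0" "\<And>i. y * x ^ i \<noteq> 1" "\<And>i. x ^ i \<noteq> y"
begin

text \<open>The order divides 4M + 1, which is odd and, modulo \<open>d\<close>, unchanged when
  \<open>M\<close> is replaced by \<open>M mod d\<close>.\<close>

lemma odd_order:
  obtains d where "d > 0" "odd d" "\<And>i. x ^ i = 1 \<longleftrightarrow> d dvd i" "d dvd 4 * (M mod d) + 1"
proof -
  obtain d where d: "d > 0" and ord: "\<And>i. x ^ i = 1 \<longleftrightarrow> d dvd i"
    using multiplicative_order[of x "4 * M + 1"] x by auto
  have dM: "d dvd 4 * M + 1" using x by (simp only: ord)
  have "odd d"
  proof
    assume "even d"
    with dM have "2 dvd 4 * M + 1" using dvd_trans by blast
    then show False by presburger
  qed
  moreover have "(4 * (M mod d) + 1) mod d = (4 * M + 1) mod d"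
    by (metis mod_add_left_eq mod_mult_right_eq)
  then have "d dvd 4 * (M mod d) + 1" using dM by (metis mod_0_imp_dvd dvd_imp_mod_0)
  ultimately show thesis using that d ord by blast
qed

text \<open>[n] vanishes and the other factors have values.\<close>

lemma hasval_rhs_root_of_unity:
  "ev.hasval x y ((\<Prod>j<M. (1 - rq ^ (4 * j + 2)) / (1 - rq ^ (4 * j + 4))) *
     ((1 - rq ^ (4 * M + 1)) / (1 - rq)) * inverse (rq ^ M)) 0"
proof -
  obtain d where d: "d > 0" "odd d" and ord: "\<And>i. x ^ i = 1 \<longleftrightarrow> d dvd i"
    and e: "d dvd 4 * (M mod d) + 1"
    using odd_order by blast
  have x0: "x \<noteq> 0" using x by auto
  \<comment> \<open>The position of the vanishing numerator in each block: modulo \<open>d\<close>,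
    4e' + 2 is 2(4(M mod d) + 1), hence 0.\<close>
  define e' where "e' = 2 * (M mod d) mod d"
  have "(4 * e' + 2) mod d = (2 * (4 * (M mod d) + 1)) mod d"
  proof -
    have "(4 * e' + 2) mod d = (4 * (2 * (M mod d)) + 2) mod d"
      unfolding e'_def by (metis mod_add_left_eq mod_mult_right_eq)
    then show ?thesis by simp
  qed
  moreover have "d dvd 2 * (4 * (M mod d) + 1)" using e by (rule dvd_mult)
  ultimately have e': "d dvd 4 * e' + 2" by (metis mod_0_imp_dvd dvd_imp_mod_0)
  have "e' < d" using d by (simp add: e'_def)
  from qpoch_ratio_regular[OF char d ord this e', of y] obtain u where
    u: "\<And>l s. s < d \<Longrightarrow> ev.hasval x y (\<Prod>j<l * d + s. (1 - rq ^ (4 * j + 2)) / (1 - rq ^ (4 * j + 4)))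
      (u l * (\<Prod>j<s. (1 - x ^ (4 * j + 2)) / (1 - x ^ (4 * j + 4))))"
    by blast
  from u[of "M mod d" "M div d"] d
  have "ev.hasval x y (\<Prod>j<M. (1 - rq ^ (4 * j + 2)) / (1 - rq ^ (4 * j + 4)))
      (u (M div d) * (\<Prod>j<M mod d. (1 - x ^ (4 * j + 2)) / (1 - x ^ (4 * j + 4))))"
    by simp
  moreover have "ev.hasval x y ((1 - rq ^ (4 * M + 1)) / (1 - rq)) ((1 - x ^ (4 * M + 1)) / (1 - x))"
    using x1 by (intro ev.hasval_intros hasval_rq) simp
  moreover have "ev.hasval x y (inverse (rq ^ M)) (inverse (x ^ M))"
    using x0 by (intro ev.hasval_inverse ev.hasval_intros hasval_rq) simp
  ultimately have "ev.hasval x y ((\<Prod>j<M. (1 - rq ^ (4 * j + 2)) / (1 - rq ^ (4 * j + 4))) *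
     ((1 - rq ^ (4 * M + 1)) / (1 - rq)) * inverse (rq ^ M))
     ((u (M div d) * (\<Prod>j<M mod d. (1 - x ^ (4 * j + 2)) / (1 - x ^ (4 * j + 4)))) *
       ((1 - x ^ (4 * M + 1)) / (1 - x)) * inverse (x ^ M))"
    by (intro ev.hasval_mult)
  then show ?thesis by (simp only: x) simp
qed

text \<open>The value at k = l d + s is a factor depending on \<open>l\<close> times a summand in
  \<open>s\<close>; each block then sums to 0 by \<open>antisymmetric_block_sum\<close>.\<close>

lemma hasval_sum_root_of_unity: "ev.hasval x y (\<Sum>k\<le>M. summand rq ra k) 0"
proof -
  obtain d where d: "d > 0" "odd d" and ord: "\<And>i. x ^ i = 1 \<longleftrightarrow> d dvd i"
    and e_dvd: "d dvd 4 * (M mod d) + 1"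
    using odd_order by blast
  define e where "e = M mod d"
  have ed: "e < d" using d by (simp add: e_def)
  have xd: "x ^ d = 1" by (simp add: ord)
  note xmod = power_eq_mod_order[OF xd]
  have e_dvd: "d dvd 4 * e + 1" using e_dvd by (simp add: e_def)
  then have xe: "x ^ (4 * e + 1) = 1" by (simp only: ord)
  define g where "g s = (\<Prod>j<s. (1 - x ^ (4 * j + 1)) / (1 - x ^ (4 * j + 4)))" for s
  define w where "w s = (\<Prod>j<s. (1 - y * x ^ (4 * j + 1)) * (1 - x ^ (4 * j + 1) / y) /
        ((1 - y * x ^ (4 * j + 4)) * (1 - x ^ (4 * j + 4) / y)))" for s
  obtain u where u: "\<And>l s. s < d \<Longrightarrow>
      ev.hasval x y (\<Prod>j<l * d + s. (1 - rq ^ (4 * j + 1)) / (1 - rq ^ (4 * j + 4))) (u l * g s)"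
    using qpoch_ratio_regular[OF char d ord ed e_dvd, of y] unfolding g_def by blast
  have den: "x ^ (4 * j + 4) \<noteq> 1" if "j < e" for j
    using power_4_Suc_neq_1[OF d(2) ord] that ed by simp
  \<comment> \<open>Since x^d = 1, the factors containing \<open>y\<close> have period
    \<open>d\<close>.\<close>
  have w_mod: "w (l * d + s) = w (l * d) * w s" for l s
  proof -
    define f where "f j = (1 - y * x ^ (4 * j + 1)) * (1 - x ^ (4 * j + 1) / y) /
        ((1 - y * x ^ (4 * j + 4)) * (1 - x ^ (4 * j + 4) / y))" for j
    have f_mod: "f (l * d + j) = f j" for l j
      unfolding f_def by (simp only: xmod)
    have w_f: "w s = (\<Prod>j<s. f j)" for s
      by (simp only: w_def f_def)
    have "w (k + s) = w k * (\<Prod>j<s. f (k + j))" for k s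
      unfolding w_f by (induction s) simp_all
    then show ?thesis by (simp only: f_mod w_f)
  qed
  define B where "B l s = (1 - x ^ (8 * s + 1)) / (1 - x) * x ^ (2 * s) * (u l * g s)\<^sup>2 * (w (l * d) * w s)" for l s
  have hv: "ev.hasval x y (summand rq ra (l * d + s)) (B l s)" if "s < d" for l s
  proof -
    have "ev.hasval x y (summand rq ra (l * d + s)) ((1 - x ^ (8 * (l * d + s) + 1)) / (1 - x) *
        x ^ (2 * (l * d + s)) * (u l * g s)\<^sup>2 * w (l * d + s))"
      unfolding summand_def w_def using x1 y
      by (intro ev.hasval_mult ev.hasval_power u[OF that] ev.hasval_divide ev.hasval_prod ev.hasval_diff
          ev.hasval_1 hasval_rq hasval_ra) auto
    moreover have "x ^ (2 * (l * d + s)) = x ^ (2 * s)" using xmod[of 2 l s 0] by simp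
    ultimately show ?thesis by (simp only: B_def xmod w_mod)
  qed
  define V where "V k = B (k div d) (k mod d)" for k
  have "ev.hasval x y (\<Sum>k\<le>M. summand rq ra k) (\<Sum>k\<le>M. V k)"
  proof (rule ev.hasval_sum)
    fix k
    show "ev.hasval x y (summand rq ra k) (V k)"
      using hv[of "k mod d" "k div d"] d by (simp add: V_def)
  qed
  moreover have "(\<Sum>k\<le>M. V k) = 0"
  proof -
    \<comment> \<open>\<open>g s\<close> with s > e contains the numerator 1 - x^(4e+1) = 0.\<close>
    have B0: "B l s = 0" if "e < s" for l s
    proof -
      have "g s = 0" unfolding g_def using that xe by (intro prod_zero) auto
      then show ?thesis by (simp add: B_def)
    qed
    define r where "r = M div d"
    have M: "M = r * d + e" by (simp add: r_def e_def)
    \<comment> \<open>\<open>M\<close> is at position \<open>e\<close> of block \<open>r\<close>, so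
      completing that block adds only zeros.\<close>
    have "(\<Sum>k\<le>M. V k) = (\<Sum>k<Suc r * d. V k)"
    proof (rule sum.mono_neutral_left)
      show "{..M} \<subseteq> {..<Suc r * d}" using M ed by auto
      show "\<forall>k\<in>{..<Suc r * d} - {..M}. V k = 0"
      proof
        fix k assume "k \<in> {..<Suc r * d} - {..M}"
        then have k: "r * d + e < k" "k < Suc r * d" using M by auto
        define s where "s = k - r * d"
        have s: "k = r * d + s" "e < s" "s < d" using k by (simp_all add: s_def)
        then have "k mod d = s" by simp
        with s show "V k = 0" by (simp add: V_def B0)
      qed
    qed simp
    also have "\<dots> = (\<Sum>l<Suc r. sum V {l * d..<l * d + d})"
      by (rule sum.nat_group[symmetric])
    also have "\<dots> = 0"
    proof (rule sum.neutral, rule ballI)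
      fix l
      have "sum V {l * d..<l * d + d} = (\<Sum>s<d. V (s + l * d))"
        using sum.shift_bounds_nat_ivl[of V 0 "l * d" d] by (simp add: atLeast0LessThan add.commute)
      also have "\<dots> = (\<Sum>s<d. B l s)"
        using d by (intro sum.cong) (simp_all add: V_def)
      also have "\<dots> = (\<Sum>s\<le>e. B l s)"
        using ed B0 by (intro sum.mono_neutral_right) auto
      also have "\<dots> = (u l)\<^sup>2 * w (l * d) / (1 - x) * (\<Sum>s\<le>e. (1 - x ^ (8 * s + 1)) * x ^ (2 * s) *
          (\<Prod>j<s. ((1 - x ^ (4 * j + 1))\<^sup>2 * (1 - y * x ^ (4 * j + 1)) * (1 - x ^ (4 * j + 1) / y)) /
            ((1 - x ^ (4 * j + 4))\<^sup>2 * (1 - y * x ^ (4 * j + 4)) * (1 - x ^ (4 * j + 4) / y))))"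
        unfolding sum_distrib_left
      proof (rule sum.cong[OF refl])
        fix s
        have "(g s)\<^sup>2 * w s = (\<Prod>j<s. ((1 - x ^ (4 * j + 1))\<^sup>2 * (1 - y * x ^ (4 * j + 1)) * (1 - x ^ (4 * j + 1) / y)) /
            ((1 - x ^ (4 * j + 4))\<^sup>2 * (1 - y * x ^ (4 * j + 4)) * (1 - x ^ (4 * j + 4) / y)))"
          unfolding g_def w_def prod_power_distrib prod.distrib[symmetric]
          by (simp add: power_divide mult.assoc)
        then show "B l s = (u l)\<^sup>2 * w (l * d) / (1 - x) * ((1 - x ^ (8 * s + 1)) * x ^ (2 * s) * (\<Prod>j<s. ((1 - x ^ (4 * j + 1))\<^sup>2 * (1 - y * x ^ (4 * j + 1)) * (1 - x ^ (4 * j + 1) / y)) /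
            ((1 - x ^ (4 * j + 4))\<^sup>2 * (1 - y * x ^ (4 * j + 4)) * (1 - x ^ (4 * j + 4) / y))))"
          unfolding B_def by (simp add: power_mult_distrib ac_simps)
      qed
      also have "\<dots> = 0"
        using char[of 2] xe y den by (subst antisymmetric_block_sum) auto
      finally show "sum V {l * d..<l * d + d} = 0" .
    qed
    finally show ?thesis .
  qed
  ultimately show ?thesis by simp
qed

end

section \<open>Back to q-Pochhammer symbols; the congruence\<close>

lemma qpoch_ratio_eq:
  "qpoch (rq ^ t) (rq ^ 4) k / qpoch (rq ^ 4) (rq ^ 4) k = (\<Prod>j<k. (1 - rq ^ (4 * j + t)) / (1 - rq ^ (4 * j + 4)))"
  unfolding qpoch_def prod_dividef[symmetric]
  by (simp add: power_mult[symmetric] power_add[symmetric] add.commute)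

lemma qpoch_summand_eq:
  "qint (8 * k + 1)
       * (qpoch rq (rq ^ 4) k)\<^sup>2 * qpoch (ra * rq) (rq ^ 4) k * qpoch (rq / ra) (rq ^ 4) k
       / ((qpoch (rq ^ 4) (rq ^ 4) k)\<^sup>2 * qpoch (ra * rq ^ 4) (rq ^ 4) k
          * qpoch (rq ^ 4 / ra) (rq ^ 4) k)
       * rq ^ (2 * k) = summand rq ra k"
proof -
  have a: "qpoch (ra * rq ^ t) (rq ^ 4) k = (\<Prod>j<k. 1 - ra * rq ^ (4 * j + t))" for t
    by (simp add: qpoch_def power_mult[symmetric] power_add[symmetric] add.commute mult.assoc)
  have b: "qpoch (rq ^ t / ra) (rq ^ 4) k = (\<Prod>j<k. 1 - rq ^ (4 * j + t) / ra)" for t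
    by (simp add: qpoch_def power_mult[symmetric] power_add[symmetric] add.commute)
  have "A * B\<^sup>2 * C * D / (E\<^sup>2 * F * G) * H = A * H * (B / E)\<^sup>2 * (C * D / (F * G))"
    for A B C D E F G H :: rf
    by (simp add: power_divide ac_simps)
  note * = this[of "(1 - rq ^ (8 * k + 1)) / (1 - rq)" "qpoch rq (rq ^ 4) k"]
  show ?thesis
    unfolding summand_def qint_def *
    using qpoch_ratio_eq[of 1 k] a[of 1] a[of 4] b[of 1] b[of 4]
    by (simp add: prod_dividef prod.distrib flip: power_divide)
qed

theorem theorem3:
  fixes n :: nat
  assumes "n > 0" and "n mod 4 = 1"
  shows "cong_rf
    (\<Sum>k=0..(n - 1) div 4.
       qint (8 * k + 1)
       * (qpoch rq (rq ^ 4) k)\<^sup>2 * qpoch (ra * rq) (rq ^ 4) k * qpoch (rq / ra) (rq ^ 4) k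
       / ((qpoch (rq ^ 4) (rq ^ 4) k)\<^sup>2 * qpoch (ra * rq ^ 4) (rq ^ 4) k
          * qpoch (rq ^ 4 / ra) (rq ^ 4) k)
       * rq ^ (2 * k))
    (qpoch (rq ^ 2) (rq ^ 4) ((n - 1) div 4) / qpoch (rq ^ 4) (rq ^ 4) ((n - 1) div 4)
       * qint n * inverse (rq ^ ((n - 1) div 4)))
    (qint_poly n * (1 - av * qv ^ n) * (av - qv ^ n))"
proof -
  define M where "M = (n - 1) div 4"
  have n: "n = 4 * M + 1" using assms unfolding M_def by presburger
  define A where "A = (\<Sum>k\<le>M. summand rq ra k)"
  define C where "C = (\<Prod>j<M. (1 - rq ^ (4 * j + 2)) / (1 - rq ^ (4 * j + 4))) *
     ((1 - rq ^ (4 * M + 1)) / (1 - rq)) * inverse (rq ^ M)"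
  obtain N D where ND: "A - C = Fract N D" "D \<noteq> 0" "coprime N D"
    by (rule ex_reduced_Fract)
  \<comment> \<open>\<open>C\<close> is free of a, so a substitution that fixes q returns
    \<open>C\<close> itself.\<close>
  have C_val: "ev.hasval rq a C C" if "a \<noteq> 0" for a
    unfolding C_def
    by (intro ev.hasval_inverse ev.hasval_intros hasval_rq) simp_all
  have kill: "ev rq a N = 0" if "a = rq ^ n \<or> a = 1 / rq ^ n" for a
  proof -
    have a0: "a \<noteq> 0" using that by auto
    have "(\<Sum>k\<le>M. summand rq a k) = C"
      using that sum_summand_power[OF rq_power_eq_iff rq_neq_0, of M]
      by (auto simp: C_def n summand_inverse simp del: power_Suc)
    moreover have "ev.hasval rq a A (\<Sum>k\<le>M. summand rq a k)"
      unfolding A_def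
    proof (intro ev.hasval_sum hasval_summand)
      fix k j assume kj: "k \<in> {..M}" "j < k"
      \<comment> \<open>n is 1 modulo 4, so no denominator vanishes at a = q^n or its
        inverse.\<close>
      have ne: "4 * j + 4 \<noteq> n" unfolding n by presburger
      have 1: "rq ^ n * rq ^ (4 * j + 4) \<noteq> 1"
        unfolding power_add[symmetric] by (rule rq_power_neq_1) simp
      have 2: "rq ^ (4 * j + 4) \<noteq> rq ^ n" using ne by (simp only: rq_power_eq_iff) simp
      show "a * rq ^ (4 * j + 4) \<noteq> 1" "rq ^ (4 * j + 4) \<noteq> a"
        using that
      proof (atomize (full), elim disjE)
        assume "a = rq ^ n"
        then show "a * rq ^ (4 * j + 4) \<noteq> 1 \<and> rq ^ (4 * j + 4) \<noteq> a" using 1 2 by simp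
      next
        assume a: "a = 1 / rq ^ n"
        show "a * rq ^ (4 * j + 4) \<noteq> 1 \<and> rq ^ (4 * j + 4) \<noteq> a"
          unfolding a using 1 2 by (simp add: divide_eq_eq eq_divide_eq mult.commute)
      qed
    qed (use a0 in auto)
    ultimately have "ev.hasval rq a (Fract N D) 0"
      using ev.hasval_diff[of rq a A C C C] C_val[OF a0] by (simp add: ND(1)[symmetric])
    then show ?thesis using ND(2) by (rule ev.hom_eq_0_if_hasval_0)
  qed
  let ?P1 = "1 - av * qv ^ n" and ?P2 = "av - qv ^ n"
  have emb_qv: "qv ^ k = map_poly (\<lambda>c. [:c:]) (monom 1 k)" for k
    unfolding qv_power by (subst map_poly_monom) (simp_all add: one_pCons)
  have emb_1: "1 = map_poly (\<lambda>c. [:c:]) (1 :: int poly)"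
    by (simp add: one_pCons map_poly_pCons)
  \<comment> \<open>Here \<open>v = q^n\<close> and \<open>w = 1\<close>; for the second factor
    these are exchanged.\<close>
  have dvd1: "?P1 dvd F" if "ev rq (1 / rq ^ n) F = 0" for F
  proof (rule dvd_if_ev_eq_0[OF _ emb_qv emb_1 _ poly_of_int_rq _ that])
    show "?P1 dvd 1 - qv ^ n * av" by (simp add: mult.commute)
    show "coprime ?P1 (qv ^ n)"
    proof (rule coprimeI)
      fix c assume "c dvd ?P1" "c dvd qv ^ n"
      then have "c dvd ?P1 + av * qv ^ n" by (intro dvd_add dvd_mult)
      then show "is_unit c" by simp
    qed
  qed simp_all
  have dvd2: "?P2 dvd F" if "ev rq (rq ^ n) F = 0" for F
  proof (rule dvd_if_ev_eq_0[OF _ emb_1 emb_qv _ poly_of_int_rq _ that])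
    show "?P2 dvd qv ^ n - 1 * av" by (metis dvd_minus_iff dvd_refl minus_diff_eq mult_1)
  qed simp_all
  obtain N1 where N1: "N = ?P1 * N1"
    using dvd1[OF kill] by auto
  \<comment> \<open>At a = q^n the first factor is 1 - q^(2n), not 0, so the cofactor inherits the
    zero of \<open>N\<close>.\<close>
  have "ev rq (rq ^ n) ?P1 \<noteq> 0"
    using assms(1) by (simp add: power_add[symmetric])
  moreover have "ev rq (rq ^ n) N = 0" by (rule kill) simp
  ultimately have "ev rq (rq ^ n) N1 = 0" unfolding N1 ev.hom_mult by simp
  then obtain N2 where N2: "N1 = ?P2 * N2" using dvd2 by blast
  have "qint_poly n dvd N2"
  proof (rule qint_poly_dvd_if[OF assms(1)])
    fix z :: complex assume z: "z ^ n = 1" "z \<noteq> 1"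
    \<comment> \<open>q becomes a constant of C(a) and a stays transcendental, so that factors with
      a cannot vanish.\<close>
    let ?x = "Fract [:z:] 1" and ?y = "Fract [:0, 1:] 1 :: complex poly fract"
    have xk: "?x ^ k = Fract [:z ^ k:] 1" for k
      by (induction k) (simp_all add: One_fract_def one_pCons mult.commute)
    have x: "?x ^ (4 * M + 1) = 1"
      using z(1) by (simp only: xk n[symmetric]) (simp add: One_fract_def one_pCons)
    have x1: "?x \<noteq> 1" using z(2) by (simp add: One_fract_def eq_fract one_pCons)
    have y: "?y \<noteq> 0" "?y * ?x ^ i \<noteq> 1" "?x ^ i \<noteq> ?y" for i
      unfolding xk by (simp_all add: One_fract_def Zero_fract_def eq_fract one_pCons)
    have char: "of_nat m \<noteq> (0 :: complex poly fract)" if "0 < m" for m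
      using that by (simp add: of_nat_fract Zero_fract_def eq_fract)
    have "ev.hasval ?x ?y (Fract N D) 0"
      using ev.hasval_diff[OF hasval_sum_root_of_unity[OF char x x1 y] hasval_rhs_root_of_unity[OF char x x1 y]]
      by (simp add: ND(1)[symmetric] A_def C_def)
    then have "ev ?x ?y N = 0" using ND(2) by (rule ev.hom_eq_0_if_hasval_0)
    moreover have "ev ?x ?y ?P1 \<noteq> 0" "ev ?x ?y ?P2 \<noteq> 0"
      using y(2)[of n] y(3)[of n] by auto
    ultimately show "ev ?x ?y N2 = 0" unfolding N1 N2 ev.hom_mult by simp
  qed
  then have "qint_poly n * (?P1 * ?P2) dvd N"
    using mult_dvd_mono[OF _ dvd_refl, of "qint_poly n" N2 "?P1 * ?P2"]
    unfolding N1 N2 by (simp only: ac_simps)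
  then have "cong_rf A C (qint_poly n * ?P1 * ?P2)"
    using cong_rfI[OF ND] by (simp add: mult.assoc)
  moreover have "qpoch (rq ^ 2) (rq ^ 4) M / qpoch (rq ^ 4) (rq ^ 4) M * qint n * inverse (rq ^ M) = C"
    unfolding qpoch_ratio_eq C_def qint_def n ..
  ultimately show ?thesis
    unfolding qpoch_summand_eq M_def[symmetric] A_def by (simp add: atLeast0AtMost)
qed

end
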